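(* Let $G$ be a finite group and let $\mathcal{L}(G)$ be its Plesken Lie algebra over $\mathbb{C}$. Then there is a bijective correspondence between the second cohomology group $H^2(\mathcal{L}(G),\mathbb{C})$ and the set of equivalence classes of central extensions of $\mathcal{L}(G)$ by $\mathbb{C}$.
   Context: For a finite group $G$, the Plesken Lie algebra $\mathcal{L}(G)$ over $\mathbb{C}$ is the linear span of the elements $\hat g = g - g^{-1}$ ($g\in G$) in the group algebra $\mathbb{C}[G]$, with Lie bracket the commutator $[x,y]=xy-yx$. $Z^2(\mathcal{L}(G),\mathbb{C})$ is the vector space of 2-cocycles: alternating bilinear maps $\alpha:\mathcal{L}(G)\times\mathcal{L}(G)\to\mathbb{C}$ satisfying $\alpha([x,y],z)+\alpha([y,z],x)+\alpha([z,x],y)=0$ for all $x,y,z\in\mathcal{L}(G)$. $B^2(\mathcal{L}(G),\mathbb{C})$ is the subspace of 2-coboundaries: bilinear maps $\alpha$ for which there exists a linear map $\sigma:\mathcal{L}(G)\to\mathbb{C}$ with $\alpha(x,y)=-\sigma([x,y])$ for all $x,y$. The second cohomology group is $H^2(\mathcal{L}(G),\mathbb{C})=Z^2(\mathcal{L}(G),\mathbb{C})/B^2(\mathcal{L}(G),\mathbb{C})$. Here $\mathbb{C}$ is regarded as the one-dimensional abelian Lie algebra. A central extension $(e;f,g)$ of $\mathcal{L}(G)$ by $\mathbb{C}$ is a short exact sequence of complex Lie algebras and Lie algebra homomorphisms $0\to\mathbb{C}\xrightarrow{f}e\xrightarrow{g}\mathcal{L}(G)\to 0$ with $f(\mathbb{C})\subseteq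 Z(e)$, where $Z(e)$ is the center of $e$. Two central extensions $(e;f,g)$ and $(e';f',g')$ of $\mathcal{L}(G)$ by $\mathbb{C}$ are equivalent if there is a Lie algebra homomorphism $\phi:e\to e'$ with $\phi\circ f=f'$ and $g'\circ\phi=g$ (such a $\phi$ is necessarily an isomorphism). *)

theory Defs
  imports
    "HOL-Algebra.Algebra"
    "HOL-Algebra.Algebraic_Closure_Type"
    "HOL-Library.Function_Algebras"
    Complex_Main
begin

section \<open>Complex Lie algebras\<close>

text \<open>
  The \<open>mult\<close> and \<open>one\<close> fields inherited from the record of modules play no role,
  neither in the locale below nor in the notion of homomorphism.
\<close>

record 'v lie_algebra = "(complex, 'v) module" +
  bracket :: "'v \<Rightarrow> 'v \<Rightarrow> 'v"

locale lie_algebra = module "ring_of_type_algebra :: complex ring" L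
  for L :: "('v, 'm) lie_algebra_scheme" (structure) +
  assumes bracket_closed:
      "\<lbrakk>x \<in> carrier L; y \<in> carrier L\<rbrakk> \<Longrightarrow> bracket L x y \<in> carrier L"
    and bracket_add_left:
      "\<lbrakk>x \<in> carrier L; y \<in> carrier L; z \<in> carrier L\<rbrakk> \<Longrightarrow>
        bracket L (x \<oplus> y) z = bracket L x z \<oplus> bracket L y z"
    and bracket_add_right:
      "\<lbrakk>x \<in> carrier L; y \<in> carrier L; z \<in> carrier L\<rbrakk> \<Longrightarrow>
        bracket L x (y \<oplus> z) = bracket L x y \<oplus> bracket L x z"
    and bracket_smult_left:
      "\<lbrakk>x \<in> carrier L; y \<in> carrier L\<rbrakk> \<Longrightarrow> bracket L (c \<odot> x) y = c \<odot> bracket L x y"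
    and bracket_smult_right:
      "\<lbrakk>x \<in> carrier L; y \<in> carrier L\<rbrakk> \<Longrightarrow> bracket L x (c \<odot> y) = c \<odot> bracket L x y"
    and bracket_self: "x \<in> carrier L \<Longrightarrow> bracket L x x = \<zero>"
    and jacobi:
      "\<lbrakk>x \<in> carrier L; y \<in> carrier L; z \<in> carrier L\<rbrakk> \<Longrightarrow>
        bracket L (bracket L x y) z \<oplus> bracket L (bracket L y z) x
          \<oplus> bracket L (bracket L z x) y = \<zero>"

definition linear_maps ::
  "(complex, 'v, 'm) module_scheme \<Rightarrow> (complex, 'w, 'n) module_scheme \<Rightarrow> ('v \<Rightarrow> 'w) set"
where
  "linear_maps M N = {\<phi>. \<phi> \<in> carrier M \<rightarrow> carrier N \<and>
     (\<forall>x\<in>carrier M. \<forall>y\<in>carrier M. \<phi> (x \<oplus>\<^bsub>M\<^esub> y) = \<phi> x \<oplus>\<^bsub>N\<^esub> \<phi> y) \<and>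
     (\<forall>c. \<forall>x\<in>carrier M. \<phi> (c \<odot>\<^bsub>M\<^esub> x) = c \<odot>\<^bsub>N\<^esub> \<phi> x)}"

definition lie_hom ::
  "('v, 'm) lie_algebra_scheme \<Rightarrow> ('w, 'n) lie_algebra_scheme \<Rightarrow> ('v \<Rightarrow> 'w) set"
where
  "lie_hom M N = {\<phi> \<in> linear_maps M N.
     \<forall>x\<in>carrier M. \<forall>y\<in>carrier M. \<phi> (bracket M x y) = bracket N (\<phi> x) (\<phi> y)}"

definition lie_center :: "('v, 'm) lie_algebra_scheme \<Rightarrow> 'v set" where
  "lie_center L = {z \<in> carrier L. \<forall>x\<in>carrier L. bracket L z x = \<zero>\<^bsub>L\<^esub>}"

definition abelian_complex :: "complex lie_algebra" where
  "abelian_complex =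
     \<lparr>carrier = UNIV, monoid.mult = (*), one = 1, ring.zero = 0, ring.add = (+), module.smult = (*),
      bracket = (\<lambda>_ _. 0)\<rparr>"


section \<open>The Plesken Lie algebra of a finite group\<close>

text \<open>
  For finite \<open>G\<close>, an element \<open>\<Sum>g. a\<^sub>g g\<close> of \<open>\<complex>[G]\<close> is the function \<open>g \<mapsto> a\<^sub>g\<close>, which is
  zero outside the carrier of \<open>G\<close>. Addition, subtraction and zero are the pointwise
  operations on functions.
\<close>

definition ga_carrier :: "('g, 'm) monoid_scheme \<Rightarrow> ('g \<Rightarrow> complex) set" where
  "ga_carrier G = {a. \<forall>x. x \<notin> carrier G \<longrightarrow> a x = 0}"

definition ga_mult ::
  "('g, 'm) monoid_scheme \<Rightarrow> ('g \<Rightarrow> complex) \<Rightarrow> ('g \<Rightarrow> complex) \<Rightarrow> ('g \<Rightarrow> complex)"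
where
  "ga_mult G a b =
     (\<lambda>x. \<Sum>(g, h) \<in> {(g, h). g \<in> carrier G \<and> h \<in> carrier G \<and> g \<otimes>\<^bsub>G\<^esub> h = x}. a g * b h)"

definition ga_basis :: "'g \<Rightarrow> 'g \<Rightarrow> complex" where
  "ga_basis g = (\<lambda>x. if x = g then 1 else 0)"

definition ga_smult :: "complex \<Rightarrow> ('g \<Rightarrow> complex) \<Rightarrow> ('g \<Rightarrow> complex)" where
  "ga_smult c a = (\<lambda>x. c * a x)"

definition group_algebra :: "('g, 'm) monoid_scheme \<Rightarrow> (complex, 'g \<Rightarrow> complex) module" where
  "group_algebra G =
     \<lparr>carrier = ga_carrier G, monoid.mult = ga_mult G, one = ga_basis \<one>\<^bsub>G\<^esub>,
      ring.zero = 0, ring.add = (+), module.smult = ga_smult\<rparr>"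

definition plesken_gen :: "('g, 'm) monoid_scheme \<Rightarrow> 'g \<Rightarrow> ('g \<Rightarrow> complex)" where
  "plesken_gen G g = ga_basis g - ga_basis (inv\<^bsub>G\<^esub> g)"

definition plesken :: "('g, 'm) monoid_scheme \<Rightarrow> ('g \<Rightarrow> complex) lie_algebra" where
  "plesken G =
     (let A = group_algebra G in
      \<lparr>carrier = Modules.module.span (module.smult A) (plesken_gen G ` carrier G),
       monoid.mult = monoid.mult A, one = one A, ring.zero = ring.zero A, ring.add = ring.add A, module.smult = module.smult A,
       bracket = (\<lambda>x y. x \<otimes>\<^bsub>A\<^esub> y - y \<otimes>\<^bsub>A\<^esub> x)\<rparr>)"


section \<open>Second cohomology with trivial coefficients\<close>

text \<open>
  A bilinear form on \<open>L\<close> is represented by the function that is zero outside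
  \<open>carrier L \<times> carrier L\<close>, so that distinct functions are distinct forms.
\<close>

definition bilinear_forms ::
  "('v, 'm) lie_algebra_scheme \<Rightarrow> ('v \<Rightarrow> 'v \<Rightarrow> complex) set"
where
  "bilinear_forms L = {\<alpha>.
     (\<forall>x\<in>carrier L. \<alpha> x \<in> linear_maps L abelian_complex) \<and>
     (\<forall>y\<in>carrier L. (\<lambda>x. \<alpha> x y) \<in> linear_maps L abelian_complex) \<and>
     (\<forall>x y. x \<notin> carrier L \<or> y \<notin> carrier L \<longrightarrow> \<alpha> x y = 0)}"

definition Z2 :: "('v, 'm) lie_algebra_scheme \<Rightarrow> ('v \<Rightarrow> 'v \<Rightarrow> complex) set" where
  "Z2 L = {\<alpha> \<in> bilinear_forms L.
     (\<forall>x\<in>carrier L. \<alpha> x x = 0) \<and>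
     (\<forall>x\<in>carrier L. \<forall>y\<in>carrier L. \<forall>z\<in>carrier L.
        \<alpha> (bracket L x y) z + \<alpha> (bracket L y z) x + \<alpha> (bracket L z x) y = 0)}"

definition B2 :: "('v, 'm) lie_algebra_scheme \<Rightarrow> ('v \<Rightarrow> 'v \<Rightarrow> complex) set" where
  "B2 L = {\<alpha> \<in> bilinear_forms L.
     \<exists>\<sigma> \<in> linear_maps L abelian_complex.
       \<forall>x\<in>carrier L. \<forall>y\<in>carrier L. \<alpha> x y = - \<sigma> (bracket L x y)}"

definition Z2_group :: "('v, 'm) lie_algebra_scheme \<Rightarrow> ('v \<Rightarrow> 'v \<Rightarrow> complex) monoid" where
  "Z2_group L = \<lparr>carrier = Z2 L, monoid.mult = (+), one = 0\<rparr>"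

definition H2 :: "('v, 'm) lie_algebra_scheme \<Rightarrow> ('v \<Rightarrow> 'v \<Rightarrow> complex) set monoid" where
  "H2 L = Z2_group L Mod B2 L"


section \<open>Central extensions by the one-dimensional abelian Lie algebra\<close>

text \<open>
  The type \<open>'e\<close> is the universe from which the carriers of the extensions are drawn. As \<open>f\<close> is
  injective, there are no extensions at all unless \<open>\<complex>\<close> embeds into \<open>'e\<close>; if it does, then every
  central extension of a finite-dimensional \<open>L\<close>, on whatever carrier, has a copy in \<open>'e\<close>.
\<close>

type_synonym ('e, 'v) extension = "'e lie_algebra \<times> (complex \<Rightarrow> 'e) \<times> ('e \<Rightarrow> 'v)"

definition central_extensions ::
  "('v, 'm) lie_algebra_scheme \<Rightarrow> ('e, 'v) extension set"
where
  "central_extensions L = {(e, f, g).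
     lie_algebra e \<and> f \<in> lie_hom abelian_complex e \<and> g \<in> lie_hom e L \<and>
     inj f \<and> range f = {x \<in> carrier e. g x = \<zero>\<^bsub>L\<^esub>} \<and> g ` carrier e = carrier L \<and>
     range f \<subseteq> lie_center e}"

text \<open>
  The functions \<open>g\<close> and \<open>g'\<close> are compared on carriers only. In particular, triples that differ
  only outside the carrier of \<open>e\<close>, or in the unused record fields, are equivalent.
\<close>

definition ext_equiv ::
  "('v, 'm) lie_algebra_scheme \<Rightarrow> (('e, 'v) extension \<times> ('e, 'v) extension) set"
where
  "ext_equiv L = {((e, f, g), (e', f', g')).
     (e, f, g) \<in> central_extensions L \<and> (e', f', g') \<in> central_extensions L \<and>
     (\<exists>\<phi> \<in> lie_hom e e'. (\<forall>c. \<phi> (f c) = f' c) \<and> (\<forall>x\<in>carrier e. g' (\<phi> x) = g x))}"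

definition extension_classes ::
  "('v, 'm) lie_algebra_scheme \<Rightarrow> ('e, 'v) extension set set"
where
  "extension_classes L = central_extensions L // ext_equiv L"

end

theory Submission
  imports Defs
begin

text \<open>
  A linear section \<open>s\<close> of a central extension \<open>(e; f, g)\<close> splits \<open>e\<close> as \<open>L \<times> \<complex>\<close>, and the failure
  of \<open>s\<close> to preserve brackets is a 2-cocycle \<open>\<alpha>\<close> with \<open>e\<close> equivalent to \<open>L \<times> \<complex>\<close> under the bracket
  \<open>[(x, a), (y, b)] = ([x, y], \<alpha> x y)\<close>. A morphism between the extensions of \<open>\<alpha>\<close> and \<open>\<beta>\<close> has the form
  \<open>(x, a) \<mapsto> (x, a + \<sigma> x)\<close>, and it preserves brackets exactly if \<open>\<alpha> - \<beta> = - \<sigma> \<circ> [_, _]\<close>. Since the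
  Plesken algebra is a finite-dimensional Lie algebra, sections exist and \<open>L \<times> \<complex>\<close> has a copy in
  every type that contains \<open>\<complex>\<close>.
\<close>

section \<open>Lie algebras and linear maps\<close>

lemma type_algebra_simps [simp]:
  "carrier (ring_of_type_algebra :: complex ring) = UNIV"
  "x \<otimes>\<^bsub>(ring_of_type_algebra :: complex ring)\<^esub> y = x * y"
  "x \<oplus>\<^bsub>(ring_of_type_algebra :: complex ring)\<^esub> y = x + y"
  "\<one>\<^bsub>(ring_of_type_algebra :: complex ring)\<^esub> = 1"
  "\<zero>\<^bsub>(ring_of_type_algebra :: complex ring)\<^esub> = 0"
  by (auto simp: ring_of_type_algebra_def)

lemma abelian_complex_simps [simp]:
  "carrier abelian_complex = UNIV"
  "x \<oplus>\<^bsub>abelian_complex\<^esub> y = x + y"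
  "c \<odot>\<^bsub>abelian_complex\<^esub> y = c * y"
  "\<zero>\<^bsub>abelian_complex\<^esub> = 0"
  "bracket abelian_complex x y = 0"
  by (auto simp: abelian_complex_def)

lemma (in lie_algebra) scalar:
  assumes "x \<in> carrier L"
  shows scalar_closed: "c \<odot>\<^bsub>L\<^esub> x \<in> carrier L"
    and scalar_add_left: "(c + d) \<odot>\<^bsub>L\<^esub> x = c \<odot>\<^bsub>L\<^esub> x \<oplus>\<^bsub>L\<^esub> d \<odot>\<^bsub>L\<^esub> x"
    and scalar_add_right: "y \<in> carrier L \<Longrightarrow> c \<odot>\<^bsub>L\<^esub> (x \<oplus>\<^bsub>L\<^esub> y) = c \<odot>\<^bsub>L\<^esub> x \<oplus>\<^bsub>L\<^esub> c \<odot>\<^bsub>L\<^esub> y"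
    and scalar_assoc: "(c * d) \<odot>\<^bsub>L\<^esub> x = c \<odot>\<^bsub>L\<^esub> (d \<odot>\<^bsub>L\<^esub> x)"
    and scalar_zero: "0 \<odot>\<^bsub>L\<^esub> x = \<zero>\<^bsub>L\<^esub>"
    and scalar_one: "1 \<odot>\<^bsub>L\<^esub> x = x"
  using assms smult_closed[of c x] smult_l_distr[of c d x] smult_r_distr[of c x y]
    smult_assoc1[of c d x] smult_l_null[of x] smult_one[of x] by auto

lemma (in lie_algebra) scalar_zero_right: "c \<odot>\<^bsub>L\<^esub> \<zero>\<^bsub>L\<^esub> = \<zero>\<^bsub>L\<^esub>"
  using smult_r_null[of c] by simp

lemma (in lie_algebra) bracket_zero:
  assumes "x \<in> carrier L"
  shows "bracket L \<zero>\<^bsub>L\<^esub> x = \<zero>\<^bsub>L\<^esub>" "bracket L x \<zero>\<^bsub>L\<^esub> = \<zero>\<^bsub>L\<^esub>"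
  using bracket_smult_left[of x x 0] bracket_smult_right[of x x 0] assms
  by (auto simp: scalar_zero bracket_closed)

lemma (in lie_algebra) bracket_skew:
  assumes "x \<in> carrier L" "y \<in> carrier L"
  shows "bracket L x y \<oplus>\<^bsub>L\<^esub> bracket L y x = \<zero>\<^bsub>L\<^esub>"
proof -
  have "\<zero>\<^bsub>L\<^esub> = bracket L (x \<oplus>\<^bsub>L\<^esub> y) (x \<oplus>\<^bsub>L\<^esub> y)"
    using assms by (simp add: bracket_self)
  also have "\<dots> = bracket L x y \<oplus>\<^bsub>L\<^esub> bracket L y x"
    using assms
    by (simp only: bracket_add_left bracket_add_right M.a_closed)
      (simp add: bracket_self bracket_closed M.a_comm)
  finally show ?thesis by simp
qed

lemma linear_mapsI:
  assumes "\<And>x. x \<in> carrier M \<Longrightarrow> \<phi> x \<in> carrier N"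
    and "\<And>x y. \<lbrakk>x \<in> carrier M; y \<in> carrier M\<rbrakk> \<Longrightarrow> \<phi> (x \<oplus>\<^bsub>M\<^esub> y) = \<phi> x \<oplus>\<^bsub>N\<^esub> \<phi> y"
    and "\<And>c x. x \<in> carrier M \<Longrightarrow> \<phi> (c \<odot>\<^bsub>M\<^esub> x) = c \<odot>\<^bsub>N\<^esub> \<phi> x"
  shows "\<phi> \<in> linear_maps M N"
  using assms by (auto simp: linear_maps_def)

lemma linear_mapsD:
  assumes "\<phi> \<in> linear_maps M N" "x \<in> carrier M"
  shows "\<phi> x \<in> carrier N"
    and "y \<in> carrier M \<Longrightarrow> \<phi> (x \<oplus>\<^bsub>M\<^esub> y) = \<phi> x \<oplus>\<^bsub>N\<^esub> \<phi> y"
    and "\<phi> (c \<odot>\<^bsub>M\<^esub> x) = c \<odot>\<^bsub>N\<^esub> \<phi> x"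
  using assms by (auto simp: linear_maps_def)

lemma linear_maps_zero:
  assumes "\<phi> \<in> linear_maps M N" "lie_algebra M" "lie_algebra N"
  shows "\<phi> \<zero>\<^bsub>M\<^esub> = \<zero>\<^bsub>N\<^esub>"
proof -
  interpret M: lie_algebra M by fact
  interpret N: lie_algebra N by fact
  show ?thesis
    using linear_mapsD[OF assms(1) M.zero_closed] M.scalar_zero[OF M.zero_closed]
      N.scalar_zero by metis
qed

lemma lie_homI:
  assumes "\<phi> \<in> linear_maps M N"
    and "\<And>x y. \<lbrakk>x \<in> carrier M; y \<in> carrier M\<rbrakk> \<Longrightarrow>
           \<phi> (bracket M x y) = bracket N (\<phi> x) (\<phi> y)"
  shows "\<phi> \<in> lie_hom M N"
  using assms by (auto simp: lie_hom_def)

lemma lie_homD: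
  assumes "\<phi> \<in> lie_hom M N"
  shows "\<phi> \<in> linear_maps M N"
    and "\<lbrakk>x \<in> carrier M; y \<in> carrier M\<rbrakk> \<Longrightarrow> \<phi> (bracket M x y) = bracket N (\<phi> x) (\<phi> y)"
  using assms by (auto simp: lie_hom_def)

text \<open>The ring axioms of the scalars are discharged here once, so that the module laws can be
  checked with the ordinary \<open>+\<close> and \<open>*\<close> of the complex numbers.\<close>

lemma lie_algebraI:
  assumes "abelian_group L"
    and "\<And>c x. x \<in> carrier L \<Longrightarrow> c \<odot>\<^bsub>L\<^esub> x \<in> carrier L"
    and "\<And>c d x. x \<in> carrier L \<Longrightarrow> (c + d) \<odot>\<^bsub>L\<^esub> x = c \<odot>\<^bsub>L\<^esub> x \<oplus>\<^bsub>L\<^esub> d \<odot>\<^bsub>L\<^esub> x"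
    and "\<And>c x y. \<lbrakk>x \<in> carrier L; y \<in> carrier L\<rbrakk> \<Longrightarrow>
           c \<odot>\<^bsub>L\<^esub> (x \<oplus>\<^bsub>L\<^esub> y) = c \<odot>\<^bsub>L\<^esub> x \<oplus>\<^bsub>L\<^esub> c \<odot>\<^bsub>L\<^esub> y"
    and "\<And>c d x. x \<in> carrier L \<Longrightarrow> (c * d) \<odot>\<^bsub>L\<^esub> x = c \<odot>\<^bsub>L\<^esub> (d \<odot>\<^bsub>L\<^esub> x)"
    and "\<And>x. x \<in> carrier L \<Longrightarrow> 1 \<odot>\<^bsub>L\<^esub> x = x"
    and "lie_algebra_axioms L"
  shows "lie_algebra L"
  using assms cring_from_type_algebra
  by (intro lie_algebra.intro moduleI) auto

section \<open>The extension defined by a cocycle\<close>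

lemma Z2D:
  assumes "\<alpha> \<in> Z2 L"
  shows "\<lbrakk>x \<in> carrier L; y \<in> carrier L; z \<in> carrier L\<rbrakk> \<Longrightarrow> \<alpha> (x \<oplus>\<^bsub>L\<^esub> y) z = \<alpha> x z + \<alpha> y z"
    and "\<lbrakk>x \<in> carrier L; y \<in> carrier L; z \<in> carrier L\<rbrakk> \<Longrightarrow> \<alpha> x (y \<oplus>\<^bsub>L\<^esub> z) = \<alpha> x y + \<alpha> x z"
    and "\<lbrakk>x \<in> carrier L; y \<in> carrier L\<rbrakk> \<Longrightarrow> \<alpha> (c \<odot>\<^bsub>L\<^esub> x) y = c * \<alpha> x y"
    and "\<lbrakk>x \<in> carrier L; y \<in> carrier L\<rbrakk> \<Longrightarrow> \<alpha> x (c \<odot>\<^bsub>L\<^esub> y) = c * \<alpha> x y"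
    and "x \<in> carrier L \<Longrightarrow> \<alpha> x x = 0"
    and "\<lbrakk>x \<in> carrier L; y \<in> carrier L; z \<in> carrier L\<rbrakk> \<Longrightarrow>
           \<alpha> (bracket L x y) z + \<alpha> (bracket L y z) x + \<alpha> (bracket L z x) y = 0"
    and "x \<notin> carrier L \<or> y \<notin> carrier L \<Longrightarrow> \<alpha> x y = 0"
  using assms by (auto simp: Z2_def bilinear_forms_def linear_maps_def)

text \<open>
  The Lie algebra \<open>L \<times> \<complex>\<close> with bracket \<open>[(x, a), (y, b)] = ([x, y], \<alpha> x y)\<close>, transported to
  the type \<open>'e\<close> along \<open>h\<close>. The fields \<open>mult\<close> and \<open>one\<close> are arbitrary.
\<close>

definition cocycle_algebra ::
  "('v, 'm) lie_algebra_scheme \<Rightarrow> ('v \<times> complex \<Rightarrow> 'e) \<Rightarrow> ('v \<Rightarrow> 'v \<Rightarrow> complex) \<Rightarrow> 'e lie_algebra"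
where
  "cocycle_algebra L h \<alpha> =
     (let D = carrier L \<times> UNIV; p = (\<lambda>u. fst (the_inv_into D h u)); q = (\<lambda>u. snd (the_inv_into D h u)) in
      \<lparr>carrier = h ` D, monoid.mult = (\<lambda>u v. u), one = h (\<zero>\<^bsub>L\<^esub>, 0),
       ring.zero = h (\<zero>\<^bsub>L\<^esub>, 0),
       ring.add = (\<lambda>u v. h (p u \<oplus>\<^bsub>L\<^esub> p v, q u + q v)),
       module.smult = (\<lambda>c u. h (c \<odot>\<^bsub>L\<^esub> p u, c * q u)),
       bracket = (\<lambda>u v. h (bracket L (p u) (p v), \<alpha> (p u) (p v)))\<rparr>)"

definition cocycle_extension ::
  "('v, 'm) lie_algebra_scheme \<Rightarrow> ('v \<times> complex \<Rightarrow> 'e) \<Rightarrow> ('v \<Rightarrow> 'v \<Rightarrow> complex) \<Rightarrow> ('e, 'v) extension"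
where
  "cocycle_extension L h \<alpha> =
     (cocycle_algebra L h \<alpha>, \<lambda>c. h (\<zero>\<^bsub>L\<^esub>, c), \<lambda>u. fst (the_inv_into (carrier L \<times> UNIV) h u))"

text \<open>Injectivity is asked only on \<open>carrier L \<times> UNIV\<close>, because the type
  \<open>'v\<close> may be far larger than the carrier: for a finite group inside an infinite type,
  \<open>'v\<close> consists of all functions on that type.\<close>

locale embedded_lie_algebra = lie_algebra L for L :: "('v, 'm) lie_algebra_scheme" +
  fixes h :: "'v \<times> complex \<Rightarrow> 'e"
  assumes inj_h: "inj_on h (carrier L \<times> UNIV)"
begin

lemma inv_h [simp]:
  "x \<in> carrier L \<Longrightarrow> the_inv_into (carrier L \<times> UNIV) h (h (x, a)) = (x, a)"
  using inj_h by (simp add: the_inv_into_f_f)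

lemma h_eq_iff [simp]:
  "\<lbrakk>x \<in> carrier L; y \<in> carrier L\<rbrakk> \<Longrightarrow> h (x, a) = h (y, b) \<longleftrightarrow> x = y \<and> a = b"
  using inj_h by (auto simp: inj_on_def)

lemma carrier_cocycle: "carrier (cocycle_algebra L h \<alpha>) = h ` (carrier L \<times> UNIV)"
  and zero_cocycle: "\<zero>\<^bsub>cocycle_algebra L h \<alpha>\<^esub> = h (\<zero>\<^bsub>L\<^esub>, 0)"
  and add_cocycle:
    "\<lbrakk>x \<in> carrier L; y \<in> carrier L\<rbrakk> \<Longrightarrow>
       h (x, a) \<oplus>\<^bsub>cocycle_algebra L h \<alpha>\<^esub> h (y, b) = h (x \<oplus>\<^bsub>L\<^esub> y, a + b)"
  and smult_cocycle:
    "x \<in> carrier L \<Longrightarrow> c \<odot>\<^bsub>cocycle_algebra L h \<alpha>\<^esub> h (x, a) = h (c \<odot>\<^bsub>L\<^esub> x, c * a)"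
  and bracket_cocycle:
    "\<lbrakk>x \<in> carrier L; y \<in> carrier L\<rbrakk> \<Longrightarrow>
       bracket (cocycle_algebra L h \<alpha>) (h (x, a)) (h (y, b)) = h (bracket L x y, \<alpha> x y)"
  by (auto simp: cocycle_algebra_def Let_def)

lemmas cocycle_simps =
  carrier_cocycle zero_cocycle add_cocycle smult_cocycle bracket_cocycle

text \<open>In the first coordinate every law is the one of \<open>L\<close>. In the second,
  bilinearity of the bracket is bilinearity of \<open>\<alpha>\<close>, \<open>[u, u] = 0\<close> is
  alternation, and Jacobi is exactly the cocycle identity.\<close>

lemma cocycle_lie_algebra:
  assumes "\<alpha> \<in> Z2 L"
  shows "lie_algebra (cocycle_algebra L h \<alpha>)"
proof -
  note Z = Z2D[OF assms]
  have "abelian_group (cocycle_algebra L h \<alpha>)"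
  proof (rule abelian_groupI)
    fix u assume "u \<in> carrier (cocycle_algebra L h \<alpha>)"
    then obtain x a where u: "u = h (x, a)" "x \<in> carrier L" by (auto simp: cocycle_simps)
    show "\<exists>v\<in>carrier (cocycle_algebra L h \<alpha>).
        v \<oplus>\<^bsub>cocycle_algebra L h \<alpha>\<^esub> u = \<zero>\<^bsub>cocycle_algebra L h \<alpha>\<^esub>"
      by (rule bexI[of _ "h (\<ominus>\<^bsub>L\<^esub> x, - a)"]) (auto simp: u cocycle_simps M.l_neg)
  qed (auto simp: cocycle_simps M.a_ac add_ac)
  moreover have "lie_algebra_axioms (cocycle_algebra L h \<alpha>)"
    by unfold_locales
      (auto simp: cocycle_simps scalar bracket_closed bracket_add_left bracket_add_right
        bracket_smult_left bracket_smult_right bracket_self jacobi Z)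
  ultimately show ?thesis
    by (intro lie_algebraI)
      (auto simp: cocycle_simps scalar algebra_simps)
qed

text \<open>The kernel of the first projection is the copy of \<open>0 \<times> \<complex>\<close>;
  it is central because both the bracket of \<open>L\<close> and \<open>\<alpha>\<close> vanish when
  their first argument is zero.\<close>

lemma cocycle_extension_central:
  assumes "\<alpha> \<in> Z2 L"
  shows "cocycle_extension L h \<alpha> \<in> central_extensions L"
proof -
  have 0: "\<alpha> \<zero>\<^bsub>L\<^esub> x = 0" if "x \<in> carrier L" for x
    using Z2D(3)[OF assms M.zero_closed that, of 0] by (simp add: scalar_zero)
  show ?thesis
    unfolding central_extensions_def cocycle_extension_def mem_Collect_eq prod.case
    by (intro conjI lie_homI linear_mapsI)
      (auto simp: cocycle_lie_algebra[OF assms] cocycle_simps scalar scalar_zero_right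
        bracket_closed bracket_zero inj_def lie_center_def 0 Z2D[OF assms] image_iff)
qed

end

section \<open>Equivalence of central extensions\<close>

lemma central_extensionsD:
  assumes "(e, f, g) \<in> central_extensions L"
  shows "lie_algebra e" "f \<in> lie_hom abelian_complex e" "g \<in> lie_hom e L" "inj f"
    and "range f = {x \<in> carrier e. g x = \<zero>\<^bsub>L\<^esub>}" "g ` carrier e = carrier L"
    and "range f \<subseteq> lie_center e"
  using assms by (auto simp: central_extensions_def)

lemma lie_hom_compose:
  assumes "\<phi> \<in> lie_hom M N" "\<psi> \<in> lie_hom N P"
  shows "(\<lambda>x. \<psi> (\<phi> x)) \<in> lie_hom M P"
  using assms by (auto simp: lie_hom_def linear_maps_def Pi_iff)

lemma lie_hom_inverse:
  assumes \<phi>: "\<phi> \<in> lie_hom M N" "bij_betw \<phi> (carrier M) (carrier N)" and "lie_algebra M"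
  shows "inv_into (carrier M) \<phi> \<in> lie_hom N M"
proof -
  interpret M: lie_algebra M by fact
  note \<phi>D = linear_mapsD[OF lie_homD(1)[OF \<phi>(1)]] lie_homD(2)[OF \<phi>(1)]
  have inj: "inj_on \<phi> (carrier M)" and img: "\<phi> ` carrier M = carrier N"
    using \<phi>(2) by (auto simp: bij_betw_def)
  note inv = f_inv_into_f[of _ \<phi> "carrier M", unfolded img]
    inv_into_into[of _ \<phi> "carrier M", unfolded img]
  \<comment> \<open>With injectivity, each law for the inverse reduces to naming a preimage, which
    is then verified by applying \<open>\<phi>\<close>.\<close>
  have eqI: "inv_into (carrier M) \<phi> y = x" if "x \<in> carrier M" "\<phi> x = y" for x y
    using that inj by auto
  show ?thesis
    by (intro lie_homI linear_mapsI eqI)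
      (auto simp: inv \<phi>D M.scalar_closed M.bracket_closed)
qed

section \<open>Fibres and morphisms of central extensions\<close>

locale central_extension = lie_algebra L for L :: "('v, 'm) lie_algebra_scheme" +
  fixes e :: "'e lie_algebra" and f :: "complex \<Rightarrow> 'e" and g :: "'e \<Rightarrow> 'v"
  assumes extension: "(e, f, g) \<in> central_extensions L"
begin

lemmas extensionD = central_extensionsD[OF extension]

sublocale e: lie_algebra e
  by (rule extensionD)

lemma f_closed: "f c \<in> carrier e"
  and f_add: "f (c + d) = f c \<oplus>\<^bsub>e\<^esub> f d"
  and f_smult: "f (c * d) = c \<odot>\<^bsub>e\<^esub> f d"
  and f_eq_iff: "f c = f d \<longleftrightarrow> c = d"
  using linear_mapsD[OF lie_homD(1)[OF extensionD(2)]] extensionD(4)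
  by (auto simp: inj_eq)

lemma f_zero: "f 0 = \<zero>\<^bsub>e\<^esub>"
  using f_smult[of 0 0] by (simp add: e.scalar_zero f_closed)

lemmas g_closed = linear_mapsD(1)[OF lie_homD(1)[OF extensionD(3)]]
  and g_add = linear_mapsD(2)[OF lie_homD(1)[OF extensionD(3)]]
  and g_smult = linear_mapsD(3)[OF lie_homD(1)[OF extensionD(3)]]
  and g_bracket = lie_homD(2)[OF extensionD(3)]

lemma g_f: "g (f c) = \<zero>\<^bsub>L\<^esub>"
  using extensionD(5) by blast

text \<open>\<open>lie_center\<close> only speaks of brackets with the central element on the left;
  the other side follows by skew-symmetry.\<close>

lemma bracket_f:
  assumes "x \<in> carrier e"
  shows "bracket e (f c) x = \<zero>\<^bsub>e\<^esub>" "bracket e x (f c) = \<zero>\<^bsub>e\<^esub>"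
proof -
  show *: "bracket e (f c) x = \<zero>\<^bsub>e\<^esub>"
    using extensionD(7) assms by (auto simp: lie_center_def)
  show "bracket e x (f c) = \<zero>\<^bsub>e\<^esub>"
    using e.bracket_skew[OF f_closed assms, of c] assms
    by (simp add: * e.bracket_closed f_closed)
qed

text \<open>By exactness the difference \<open>y - x\<close>, which lies in the kernel of
  \<open>g\<close>, is in the range of \<open>f\<close>.\<close>

lemma fibre:
  assumes "x \<in> carrier e" "y \<in> carrier e" "g x = g y"
  obtains c where "y = x \<oplus>\<^bsub>e\<^esub> f c"
proof -
  have yx: "(y \<ominus>\<^bsub>e\<^esub> x) \<oplus>\<^bsub>e\<^esub> x = y"
    using assms by (simp only: a_minus_def e.M.a_assoc e.M.l_neg e.M.a_inv_closed e.M.r_zero)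
  then have "g (y \<ominus>\<^bsub>e\<^esub> x) \<oplus>\<^bsub>L\<^esub> g x = g x"
    using assms by (metis g_add e.M.minus_closed)
  then have "g (y \<ominus>\<^bsub>e\<^esub> x) = \<zero>\<^bsub>L\<^esub>"
    using g_closed assms by (simp add: M.add.r_cancel_one)
  then have "y \<ominus>\<^bsub>e\<^esub> x \<in> range f"
    using extensionD(5) assms by auto
  then obtain c where "y \<ominus>\<^bsub>e\<^esub> x = f c"
    by auto
  then have "y = x \<oplus>\<^bsub>e\<^esub> f c"
    using yx assms by (metis e.M.a_comm f_closed)
  then show thesis ..
qed

end

text \<open>The short five lemma, by chasing fibres. If \<open>\<phi> x = \<phi> y\<close> with
  \<open>y = x + f c\<close>, then \<open>f' c = 0\<close>, so \<open>c = 0\<close>. Conversely,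
  lift \<open>g' y\<close> to some \<open>x\<close>; then \<open>y\<close> differs from
  \<open>\<phi> x\<close> by some \<open>f' c = \<phi> (f c)\<close>.\<close>

lemma extension_morphism_bij:
  assumes L: "lie_algebra L"
    and E: "(e, f, g) \<in> central_extensions L" and E': "(e', f', g') \<in> central_extensions L"
    and \<phi>: "\<phi> \<in> lie_hom e e'" "\<And>c. \<phi> (f c) = f' c" "\<And>x. x \<in> carrier e \<Longrightarrow> g' (\<phi> x) = g x"
  shows "bij_betw \<phi> (carrier e) (carrier e')"
proof -
  interpret E: central_extension L e f g
    by (intro central_extension.intro central_extension_axioms.intro L E)
  interpret E': central_extension L e' f' g'
    by (intro central_extension.intro central_extension_axioms.intro L E')
  note \<phi>D = linear_mapsD[OF lie_homD(1)[OF \<phi>(1)]]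
  have "inj_on \<phi> (carrier e)"
  proof (rule inj_onI)
    fix x y assume xy: "x \<in> carrier e" "y \<in> carrier e" "\<phi> x = \<phi> y"
    then have "g x = g y" by (metis \<phi>(3))
    then obtain c where c: "y = x \<oplus>\<^bsub>e\<^esub> f c"
      using E.fibre xy by blast
    then have "\<phi> x = \<phi> x \<oplus>\<^bsub>e'\<^esub> f' c"
      using xy by (simp add: \<phi>D(2) E.f_closed \<phi>(2))
    then have "f' c = f' 0"
      using xy \<phi>D(1) by (simp add: E'.f_closed E'.f_zero)
    then show "x = y"
      using c xy by (simp add: E'.f_eq_iff E.f_zero)
  qed
  moreover have "y \<in> \<phi> ` carrier e" if y: "y \<in> carrier e'" for y
  proof -
    obtain x where x: "x \<in> carrier e" "g x = g' y"
      using E.extensionD(6) E'.g_closed[OF y] by (metis imageE)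
    then have "g' (\<phi> x) = g' y" by (simp add: \<phi>(3))
    then obtain c where "y = \<phi> x \<oplus>\<^bsub>e'\<^esub> f' c"
      using E'.fibre[OF \<phi>D(1)[OF x(1)] y] by blast
    then have "y = \<phi> (x \<oplus>\<^bsub>e\<^esub> f c)"
      using x by (simp add: \<phi>D(2) E.f_closed \<phi>(2))
    then show ?thesis
      using x E.f_closed by blast
  qed
  ultimately show ?thesis
    using \<phi>D(1) by (auto simp: bij_betw_def)
qed

lemma ext_equivI:
  assumes "(e, f, g) \<in> central_extensions L" "(e', f', g') \<in> central_extensions L"
    and "\<phi> \<in> lie_hom e e'" "\<And>c. \<phi> (f c) = f' c" "\<And>x. x \<in> carrier e \<Longrightarrow> g' (\<phi> x) = g x"
  shows "((e, f, g), (e', f', g')) \<in> ext_equiv L"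
  using assms by (auto simp: ext_equiv_def)

text \<open>Identities and composites give reflexivity and transitivity. Symmetry is the point with
  content: a morphism of extensions is bijective, and its inverse is again a morphism.\<close>

lemma equiv_ext_equiv:
  fixes L :: "('v, 'm) lie_algebra_scheme"
  assumes L: "lie_algebra L"
  shows "equiv (central_extensions L :: ('e, 'v) extension set) (ext_equiv L)"
proof (rule equivI)
  let ?C = "central_extensions L :: ('e, 'v) extension set"
  let ?r = "ext_equiv L :: (('e, 'v) extension \<times> ('e, 'v) extension) set"
  show "?r \<subseteq> ?C \<times> ?C"
    by (auto simp: ext_equiv_def)
  show "refl_on ?C ?r"
  proof (rule refl_onI)
    fix E :: "('e, 'v) extension" assume "E \<in> central_extensions L"
    moreover obtain e f g where "E = (e, f, g)" by (cases E)
    moreover have "(\<lambda>x. x) \<in> lie_hom e e"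
      by (intro lie_homI linear_mapsI) simp_all
    ultimately show "(E, E) \<in> ext_equiv L"
      by (auto intro: ext_equivI)
  qed
  show "sym ?r"
  proof (rule symI)
    fix E E' :: "('e, 'v) extension" assume EE': "(E, E') \<in> ext_equiv L"
    obtain e f g e' f' g' where eq: "E = (e, f, g)" "E' = (e', f', g')" by (cases E, cases E')
    obtain \<phi> where E: "(e, f, g) \<in> central_extensions L" and E': "(e', f', g') \<in> central_extensions L"
      and \<phi>: "\<phi> \<in> lie_hom e e'" "\<And>c. \<phi> (f c) = f' c" "\<And>x. x \<in> carrier e \<Longrightarrow> g' (\<phi> x) = g x"
      using EE' by (auto simp: ext_equiv_def eq)
    interpret E: central_extension L e f g
      by (intro central_extension.intro central_extension_axioms.intro L E)
    have bij: "bij_betw \<phi> (carrier e) (carrier e')"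
      using extension_morphism_bij[OF L E E' \<phi>] .
    have "inv_into (carrier e) \<phi> (f' c) = f c" for c
      using bij_betw_inv_into_left[OF bij E.f_closed] by (simp add: \<phi>(2))
    moreover have "g (inv_into (carrier e) \<phi> x) = g' x" if "x \<in> carrier e'" for x
      using \<phi>(3)[of "inv_into (carrier e) \<phi> x"] bij_betw_inv_into_right[OF bij that]
        bij_betw_apply[OF bij_betw_inv_into[OF bij] that] by simp
    ultimately show "(E', E) \<in> ext_equiv L"
      using lie_hom_inverse[OF \<phi>(1) bij E.e.lie_algebra_axioms] E E' by (auto simp: eq intro: ext_equivI)
  qed
  show "trans ?r"
  proof (rule transI)
    fix E E' E'' :: "('e, 'v) extension"
    assume EE': "(E, E') \<in> ext_equiv L" and EE'': "(E', E'') \<in> ext_equiv L"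
    obtain e f g e' f' g' e'' f'' g''
      where eq: "E = (e, f, g)" "E' = (e', f', g')" "E'' = (e'', f'', g'')"
      by (cases E, cases E', cases E'')
    obtain \<phi> where E: "(e, f, g) \<in> central_extensions L"
      and \<phi>: "\<phi> \<in> lie_hom e e'" "\<And>c. \<phi> (f c) = f' c" "\<And>x. x \<in> carrier e \<Longrightarrow> g' (\<phi> x) = g x"
      using EE' by (auto simp: ext_equiv_def eq)
    obtain \<psi> where E'': "(e'', f'', g'') \<in> central_extensions L"
      and \<psi>: "\<psi> \<in> lie_hom e' e''" "\<And>c. \<psi> (f' c) = f'' c" "\<And>x. x \<in> carrier e' \<Longrightarrow> g'' (\<psi> x) = g' x"
      using EE'' by (auto simp: ext_equiv_def eq)
    show "(E, E'') \<in> ext_equiv L"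
      unfolding eq
      using E E'' lie_hom_compose[OF \<phi>(1) \<psi>(1)]
      by (rule ext_equivI) (auto simp: \<phi> \<psi> linear_mapsD(1)[OF lie_homD(1)[OF \<phi>(1)]])
  qed
qed

section \<open>Classification of the central extensions\<close>

lemma bilinear_forms_diff:
  assumes "\<alpha> \<in> bilinear_forms L" "\<beta> \<in> bilinear_forms L"
  shows "\<alpha> - \<beta> \<in> bilinear_forms L"
  using assms by (auto simp: bilinear_forms_def linear_maps_def algebra_simps)

lemma B2_diff:
  assumes "\<alpha> \<in> B2 L" "\<beta> \<in> B2 L"
  shows "\<alpha> - \<beta> \<in> B2 L"
proof -
  obtain \<sigma> \<tau> where "\<sigma> \<in> linear_maps L abelian_complex" "\<tau> \<in> linear_maps L abelian_complex"
    and "\<forall>x\<in>carrier L. \<forall>y\<in>carrier L. \<alpha> x y = - \<sigma> (bracket L x y)"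
    and "\<forall>x\<in>carrier L. \<forall>y\<in>carrier L. \<beta> x y = - \<tau> (bracket L x y)"
    using assms by (auto simp: B2_def)
  then have "(\<lambda>x. \<sigma> x - \<tau> x) \<in> linear_maps L abelian_complex"
    and "\<forall>x\<in>carrier L. \<forall>y\<in>carrier L. (\<alpha> - \<beta>) x y = - (\<sigma> (bracket L x y) - \<tau> (bracket L x y))"
    by (auto simp: linear_maps_def algebra_simps)
  moreover have "\<alpha> - \<beta> \<in> bilinear_forms L"
    using assms by (intro bilinear_forms_diff) (auto simp: B2_def)
  ultimately show ?thesis
    by (auto simp: B2_def intro!: bexI[of _ "\<lambda>x. \<sigma> x - \<tau> x"])
qed

lemma zero_in_B2: "0 \<in> B2 L"
proof -
  have "(\<lambda>_. 0) \<in> linear_maps L abelian_complex"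
    by (simp add: linear_maps_def)
  then show ?thesis
    by (auto simp: B2_def bilinear_forms_def linear_maps_def intro: exI[of _ "\<lambda>_. 0"])
qed

lemma B2_minus: "\<alpha> \<in> B2 L \<Longrightarrow> - \<alpha> \<in> B2 L"
  using B2_diff[OF zero_in_B2] by fastforce

lemma B2_add: "\<alpha> \<in> B2 L \<Longrightarrow> \<beta> \<in> B2 L \<Longrightarrow> \<alpha> + \<beta> \<in> B2 L"
  using B2_diff[of \<alpha> L "- \<beta>"] B2_minus by fastforce

text \<open>Applying \<open>\<sigma>\<close> to the Jacobi identity gives the cocycle identity, and
  applying it to \<open>[x, x] = 0\<close> gives alternation.\<close>

lemma B2_subset_Z2:
  assumes "lie_algebra L"
  shows "B2 L \<subseteq> Z2 L"
proof
  interpret lie_algebra L by fact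
  fix \<alpha> assume "\<alpha> \<in> B2 L"
  then obtain \<sigma> where \<alpha>: "\<alpha> \<in> bilinear_forms L" and \<sigma>: "\<sigma> \<in> linear_maps L abelian_complex"
    and eq: "\<And>x y. \<lbrakk>x \<in> carrier L; y \<in> carrier L\<rbrakk> \<Longrightarrow> \<alpha> x y = - \<sigma> (bracket L x y)"
    by (auto simp: B2_def)
  have \<sigma>_zero: "\<sigma> \<zero>\<^bsub>L\<^esub> = 0"
    using linear_mapsD(3)[OF \<sigma> M.zero_closed, of 0] by (simp add: scalar_zero)
  have \<sigma>_add: "\<sigma> (x \<oplus>\<^bsub>L\<^esub> y) = \<sigma> x + \<sigma> y" if "x \<in> carrier L" "y \<in> carrier L" for x y
    using linear_mapsD(2)[OF \<sigma> that] by simp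
  have "\<alpha> (bracket L x y) z + \<alpha> (bracket L y z) x + \<alpha> (bracket L z x) y = 0"
    if "x \<in> carrier L" "y \<in> carrier L" "z \<in> carrier L" for x y z
    using arg_cong[OF jacobi[OF that], of \<sigma>] that
    by (simp add: eq bracket_closed \<sigma>_add \<sigma>_zero algebra_simps add_eq_0_iff)
  then show "\<alpha> \<in> Z2 L"
    using \<alpha> by (auto simp: Z2_def eq bracket_self \<sigma>_zero)
qed

text \<open>The right cosets produced by \<open>Mod\<close>, written additively since the product of
  \<open>Z2_group\<close> is pointwise addition.\<close>

lemma carrier_H2: "carrier (H2 L) = (\<lambda>\<alpha>. {\<beta> + \<alpha> |\<beta>. \<beta> \<in> B2 L}) ` Z2 L"
  by (auto simp: H2_def FactGroup_def RCOSETS_def r_coset_def Z2_group_def)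

lemma coset_eqI:
  assumes "\<alpha> - \<beta> \<in> B2 L"
  shows "{\<gamma> + \<alpha> |\<gamma>. \<gamma> \<in> B2 L} = {\<gamma> + \<beta> |\<gamma>. \<gamma> \<in> B2 L}"
proof -
  \<comment> \<open>One inclusion for arbitrary \<open>\<alpha>\<close> and \<open>\<beta>\<close>,
    to be used in both directions.\<close>
  have *: "{\<gamma> + \<alpha> |\<gamma>. \<gamma> \<in> B2 L} \<subseteq> {\<gamma> + \<beta> |\<gamma>. \<gamma> \<in> B2 L}" if "\<alpha> - \<beta> \<in> B2 L" for \<alpha> \<beta>
  proof clarify
    fix \<gamma> assume "\<gamma> \<in> B2 L"
    then have "\<gamma> + (\<alpha> - \<beta>) \<in> B2 L"
      using B2_add that by blast
    then show "\<exists>\<gamma>'. \<gamma> + \<alpha> = \<gamma>' + \<beta> \<and> \<gamma>' \<in> B2 L"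
      by (intro exI[of _ "\<gamma> + (\<alpha> - \<beta>)"]) (auto simp: algebra_simps)
  qed
  have "\<beta> - \<alpha> \<in> B2 L"
    using B2_minus[OF assms] by simp
  then show ?thesis
    using *[OF assms] * by blast
qed

context embedded_lie_algebra
begin

text \<open>For the shear \<open>(x, a) \<mapsto> (x, a + \<sigma> x)\<close>, the second coordinate
  of the image of a bracket is \<open>\<alpha> x y + \<sigma> [x, y]\<close>, while that of the
  bracket of the images is \<open>\<beta> x y\<close>. Their equality is the coboundary condition,
  including its sign.\<close>

lemma cocycle_extension_equiv_iff:
  assumes \<alpha>: "\<alpha> \<in> Z2 L" and \<beta>: "\<beta> \<in> Z2 L"
  shows "(cocycle_extension L h \<alpha>, cocycle_extension L h \<beta>) \<in> ext_equiv L \<longleftrightarrow> \<alpha> - \<beta> \<in> B2 L"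
proof
  assume "\<alpha> - \<beta> \<in> B2 L"
  then obtain \<sigma> where \<sigma>: "\<sigma> \<in> linear_maps L abelian_complex"
    and eq: "\<And>x y. \<lbrakk>x \<in> carrier L; y \<in> carrier L\<rbrakk> \<Longrightarrow> \<beta> x y = \<alpha> x y + \<sigma> (bracket L x y)"
    by (auto simp: B2_def algebra_simps)
  have \<sigma>_zero: "\<sigma> \<zero>\<^bsub>L\<^esub> = 0"
    using linear_mapsD(3)[OF \<sigma> M.zero_closed, of 0] by (simp add: scalar_zero)
  define \<phi> where "\<phi> u = (case the_inv_into (carrier L \<times> UNIV) h u of (x, a) \<Rightarrow> h (x, a + \<sigma> x))" for u
  have \<phi>: "\<phi> (h (x, a)) = h (x, a + \<sigma> x)" if "x \<in> carrier L" for x a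
    using that by (simp add: \<phi>_def)
  have "\<phi> \<in> lie_hom (cocycle_algebra L h \<alpha>) (cocycle_algebra L h \<beta>)"
    by (intro lie_homI linear_mapsI)
      (auto simp: cocycle_simps \<phi> scalar bracket_closed eq linear_mapsD[OF \<sigma>, simplified] algebra_simps)
  then show "(cocycle_extension L h \<alpha>, cocycle_extension L h \<beta>) \<in> ext_equiv L"
    using cocycle_extension_central[OF \<alpha>] cocycle_extension_central[OF \<beta>]
    unfolding cocycle_extension_def
    by (elim ext_equivI[rotated 2]) (auto simp: cocycle_simps \<phi> \<sigma>_zero)
next
  assume "(cocycle_extension L h \<alpha>, cocycle_extension L h \<beta>) \<in> ext_equiv L"
  then obtain \<phi> where \<phi>: "\<phi> \<in> lie_hom (cocycle_algebra L h \<alpha>) (cocycle_algebra L h \<beta>)"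
    and \<phi>_f: "\<And>c. \<phi> (h (\<zero>\<^bsub>L\<^esub>, c)) = h (\<zero>\<^bsub>L\<^esub>, c)"
    and \<phi>_g: "\<And>x a. x \<in> carrier L \<Longrightarrow> fst (the_inv_into (carrier L \<times> UNIV) h (\<phi> (h (x, a)))) = x"
    by (auto simp: ext_equiv_def cocycle_extension_def cocycle_simps)
  note \<phi>D = linear_mapsD[OF lie_homD(1)[OF \<phi>]] lie_homD(2)[OF \<phi>]
  \<comment> \<open>The shear is read off from its values on the slice \<open>a = 0\<close>.\<close>
  define \<sigma> where "\<sigma> x = snd (the_inv_into (carrier L \<times> UNIV) h (\<phi> (h (x, 0))))" for x
  have \<phi>_0: "\<phi> (h (x, 0)) = h (x, \<sigma> x)" if x: "x \<in> carrier L" for x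
  proof -
    obtain y b where "\<phi> (h (x, 0)) = h (y, b)" "y \<in> carrier L"
      using \<phi>D(1)[of "h (x, 0)"] x by (auto simp: cocycle_simps)
    then show ?thesis
      using \<phi>_g[OF x, of 0] by (simp add: \<sigma>_def)
  qed
  \<comment> \<open>Split \<open>(x, a)\<close> as \<open>(x, 0) + (0, a)\<close>; the second
    summand lies in the copy of \<open>\<complex>\<close>, which \<open>\<phi>\<close>
    fixes.\<close>
  have \<phi>_eq: "\<phi> (h (x, a)) = h (x, \<sigma> x + a)" if x: "x \<in> carrier L" for x a
    using \<phi>D(2)[of "h (x, 0)" "h (\<zero>\<^bsub>L\<^esub>, a)"] x by (simp add: cocycle_simps \<phi>_0 \<phi>_f)
  have \<sigma>: "\<sigma> \<in> linear_maps L abelian_complex"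
  proof (rule linear_mapsI)
    fix x y assume xy: "x \<in> carrier L" "y \<in> carrier L"
    show "\<sigma> (x \<oplus>\<^bsub>L\<^esub> y) = \<sigma> x \<oplus>\<^bsub>abelian_complex\<^esub> \<sigma> y"
      using \<phi>D(2)[of "h (x, 0)" "h (y, 0)"] xy by (simp add: cocycle_simps \<phi>_eq)
  next
    fix c x assume x: "x \<in> carrier L"
    show "\<sigma> (c \<odot>\<^bsub>L\<^esub> x) = c \<odot>\<^bsub>abelian_complex\<^esub> \<sigma> x"
      using \<phi>D(3)[of "h (x, 0)" c] x by (simp add: cocycle_simps \<phi>_eq scalar_closed)
  qed simp
  have "(\<alpha> - \<beta>) x y = - \<sigma> (bracket L x y)" if xy: "x \<in> carrier L" "y \<in> carrier L" for x y
    using \<phi>D(4)[of "h (x, 0)" "h (y, 0)"] xy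
    by (simp add: cocycle_simps \<phi>_eq bracket_closed algebra_simps add_eq_0_iff)
  then show "\<alpha> - \<beta> \<in> B2 L"
    using \<sigma> \<alpha> \<beta> bilinear_forms_diff by (auto simp: B2_def Z2_def)
qed

end

text \<open>
  The section \<open>s\<close> splits every \<open>v\<close> as \<open>s (g v) + f (p v)\<close> with \<open>p\<close> linear, and
  \<open>\<alpha> x y = p [s x, s y]\<close> is the cocycle of the extension; \<open>v \<mapsto> (g v, p v)\<close> is the equivalence.
\<close>

lemma extension_equiv_cocycle_extension:
  fixes L :: "('v, 'm) lie_algebra_scheme" and h :: "'v \<times> complex \<Rightarrow> 'e"
  assumes "embedded_lie_algebra L h" and E: "(e, f, g) \<in> central_extensions L"
    and s: "s \<in> linear_maps L e" "\<And>x. x \<in> carrier L \<Longrightarrow> g (s x) = x"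
  shows "\<exists>\<alpha>\<in>Z2 L. ((e, f, g), cocycle_extension L h \<alpha>) \<in> ext_equiv L"
proof -
  interpret embedded_lie_algebra L h by fact
  interpret central_extension L e f g
    by unfold_locales (rule E)
  note sD = linear_mapsD[OF s(1)]
  \<comment> \<open>The elements \<open>v\<close> and \<open>s (g v)\<close> lie in the same fibre
    of \<open>g\<close>.\<close>
  have "\<exists>c. v = s (g v) \<oplus>\<^bsub>e\<^esub> f c" if "v \<in> carrier e" for v
    using fibre[of "s (g v)" v] that by (metis g_closed s(2) sD(1))
  then obtain p where p: "\<And>v. v \<in> carrier e \<Longrightarrow> v = s (g v) \<oplus>\<^bsub>e\<^esub> f (p v)"
    by metis
  \<comment> \<open>The decomposition is unique, so a value of \<open>p\<close> is established by
    exhibiting a decomposition with that central part. The linearity of \<open>p\<close> and its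
    values on \<open>f\<close> and \<open>s\<close> are all obtained in this way.\<close>
  have pI: "p v = c" if "v \<in> carrier e" "v = s (g v) \<oplus>\<^bsub>e\<^esub> f c" for v c
  proof -
    have "s (g v) \<oplus>\<^bsub>e\<^esub> f (p v) = s (g v) \<oplus>\<^bsub>e\<^esub> f c"
      using p[OF that(1)] that(2) by simp
    then show ?thesis
      using that(1) by (simp add: e.M.add.l_cancel f_closed f_eq_iff g_closed sD(1))
  qed
  have p_add: "p (v \<oplus>\<^bsub>e\<^esub> w) = p v + p w" if vw: "v \<in> carrier e" "w \<in> carrier e" for v w
  proof (rule pI)
    have "v \<oplus>\<^bsub>e\<^esub> w = (s (g v) \<oplus>\<^bsub>e\<^esub> f (p v)) \<oplus>\<^bsub>e\<^esub> (s (g w) \<oplus>\<^bsub>e\<^esub> f (p w))"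
      using p vw by metis
    also have "\<dots> = s (g (v \<oplus>\<^bsub>e\<^esub> w)) \<oplus>\<^bsub>e\<^esub> f (p v + p w)"
      using vw by (simp add: g_add g_closed sD f_add f_closed e.M.a_ac)
    finally show "v \<oplus>\<^bsub>e\<^esub> w = s (g (v \<oplus>\<^bsub>e\<^esub> w)) \<oplus>\<^bsub>e\<^esub> f (p v + p w)" .
  qed (use vw in simp)
  have p_smult: "p (c \<odot>\<^bsub>e\<^esub> v) = c * p v" if v: "v \<in> carrier e" for c v
  proof (rule pI)
    have "c \<odot>\<^bsub>e\<^esub> v = c \<odot>\<^bsub>e\<^esub> (s (g v) \<oplus>\<^bsub>e\<^esub> f (p v))"
      using p v by metis
    also have "\<dots> = s (g (c \<odot>\<^bsub>e\<^esub> v)) \<oplus>\<^bsub>e\<^esub> f (c * p v)"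
      using v by (simp add: g_smult g_closed sD f_smult f_closed e.scalar_add_right)
    finally show "c \<odot>\<^bsub>e\<^esub> v = s (g (c \<odot>\<^bsub>e\<^esub> v)) \<oplus>\<^bsub>e\<^esub> f (c * p v)" .
  qed (use v e.scalar_closed in simp)
  have p_f: "p (f c) = c" for c
    using sD(3)[OF M.zero_closed, of 0] sD(1)[OF M.zero_closed]
    by (intro pI) (simp_all add: f_closed g_f scalar_zero e.scalar_zero)
  have p_zero: "p \<zero>\<^bsub>e\<^esub> = 0"
    using p_f[of 0] by (simp add: f_zero)
  have p_s: "p (s x) = 0" if "x \<in> carrier L" for x
    using that by (intro pI) (simp_all add: sD(1) s(2) f_zero)
  \<comment> \<open>The central part \<open>f (p v)\<close> contributes nothing to a
    bracket.\<close>
  have bracket_split: "bracket e v w = bracket e (s (g v)) w" if vw: "v \<in> carrier e" "w \<in> carrier e" for v w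
  proof -
    have "bracket e v w = bracket e (s (g v) \<oplus>\<^bsub>e\<^esub> f (p v)) w"
      using p vw by metis
    then show ?thesis
      using vw by (simp add: e.bracket_add_left sD(1) g_closed f_closed bracket_f e.bracket_closed)
  qed
  have bracket_split': "bracket e v w = bracket e v (s (g w))" if vw: "v \<in> carrier e" "w \<in> carrier e" for v w
  proof -
    have "bracket e v w = bracket e v (s (g w) \<oplus>\<^bsub>e\<^esub> f (p w))"
      using p vw by metis
    then show ?thesis
      using vw by (simp add: e.bracket_add_right sD(1) g_closed f_closed bracket_f e.bracket_closed)
  qed
  \<comment> \<open>The value 0 off the carrier is the normalization built into
    \<open>bilinear_forms\<close>.\<close>
  define \<alpha> where
    "\<alpha> x y = (if x \<in> carrier L \<and> y \<in> carrier L then p (bracket e (s x) (s y)) else 0)" for x y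
  have \<alpha>_eq: "\<alpha> x y = p (bracket e (s x) (s y))" if "x \<in> carrier L" "y \<in> carrier L" for x y
    using that by (simp add: \<alpha>_def)
  have "\<alpha> \<in> bilinear_forms L"
    unfolding bilinear_forms_def mem_Collect_eq
    by (intro conjI ballI linear_mapsI)
      (auto simp: \<alpha>_eq \<alpha>_def scalar_closed sD e.bracket_add_left e.bracket_add_right
        e.bracket_smult_left e.bracket_smult_right e.bracket_closed p_add p_smult)
  moreover have "\<alpha> x x = 0" if "x \<in> carrier L" for x
    using that by (simp add: \<alpha>_eq e.bracket_self sD(1) p_zero)
  moreover have "\<alpha> (bracket L x y) z + \<alpha> (bracket L y z) x + \<alpha> (bracket L z x) y = 0"
    if xyz: "x \<in> carrier L" "y \<in> carrier L" "z \<in> carrier L" for x y z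
  proof -
    \<comment> \<open>Both \<open>s [x, y]\<close> and \<open>[s x, s y]\<close> lie over
      \<open>[x, y]\<close>, so they have the same bracket with \<open>s z\<close>. The cocycle
      identity thereby becomes \<open>p\<close> applied to the Jacobi identity of
      \<open>e\<close>.\<close>
    have *: "\<alpha> (bracket L x y) z = p (bracket e (bracket e (s x) (s y)) (s z))"
      if "x \<in> carrier L" "y \<in> carrier L" "z \<in> carrier L" for x y z
      using that bracket_split[of "bracket e (s x) (s y)" "s z"]
      by (simp add: \<alpha>_eq bracket_closed e.bracket_closed sD(1) g_bracket s(2))
    show ?thesis
      using arg_cong[OF e.jacobi[of "s x" "s y" "s z"], of p] xyz
      by (simp add: * p_add p_zero sD(1) e.bracket_closed)
  qed
  ultimately have \<alpha>: "\<alpha> \<in> Z2 L"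
    by (auto simp: Z2_def)
  have p_bracket: "p (bracket e v w) = \<alpha> (g v) (g w)" if "v \<in> carrier e" "w \<in> carrier e" for v w
    using that bracket_split[of v w] bracket_split'[of "s (g v)" w] by (simp add: \<alpha>_eq g_closed sD(1))
  have "(\<lambda>v. h (g v, p v)) \<in> lie_hom e (cocycle_algebra L h \<alpha>)"
    by (intro lie_homI linear_mapsI)
      (auto simp: cocycle_simps g_closed g_add g_smult g_bracket p_add p_smult p_bracket)
  then have "((e, f, g), cocycle_extension L h \<alpha>) \<in> ext_equiv L"
    using E cocycle_extension_central[OF \<alpha>] unfolding cocycle_extension_def
    by (elim ext_equivI[rotated 2]) (auto simp: g_f p_f g_closed)
  then show ?thesis
    using \<alpha> by blast
qed

text \<open>The two inputs that finite dimension will supply are isolated as hypotheses: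
  \<open>h\<close> makes room in \<open>'e\<close> for the cocycle extensions, and
  \<open>sections\<close> lets every extension be described by a cocycle.\<close>

theorem H2_classifies_central_extensions:
  fixes L :: "('v, 'm) lie_algebra_scheme" and h :: "'v \<times> complex \<Rightarrow> 'e"
  assumes L: "lie_algebra L" and h: "inj_on h (carrier L \<times> UNIV)"
    and sections: "\<And>(e :: 'e lie_algebra) g. \<lbrakk>lie_algebra e; g \<in> linear_maps e L; g ` carrier e = carrier L\<rbrakk> \<Longrightarrow>
      \<exists>s\<in>linear_maps L e. \<forall>x\<in>carrier L. g (s x) = x"
  shows "\<exists>\<Phi>. bij_betw \<Phi> (carrier (H2 L)) (extension_classes L :: ('e, 'v) extension set set)"
proof
  let ?E = "cocycle_extension L h"
  let ?C = "central_extensions L :: ('e, 'v) extension set"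
  let ?r = "ext_equiv L :: (('e, 'v) extension \<times> ('e, 'v) extension) set"
  let ?coset = "\<lambda>\<alpha>. {\<beta> + \<alpha> |\<beta>. \<beta> \<in> B2 L}"
  \<comment> \<open>Taking the union over all representatives avoids choosing one; on a coset all
    the united classes coincide.\<close>
  define \<Phi> where "\<Phi> H = (\<Union>\<alpha>\<in>H. ?r `` {?E \<alpha>})" for H
  have emb: "embedded_lie_algebra L h"
    using L h by (simp add: embedded_lie_algebra_def embedded_lie_algebra_axioms_def)
  interpret embedded_lie_algebra L h by (rule emb)
  have r: "equiv ?C ?r" by (rule equiv_ext_equiv[OF L])
  have class_eq: "?r `` {?E \<alpha>} = ?r `` {?E \<beta>} \<longleftrightarrow> \<alpha> - \<beta> \<in> B2 L" if "\<alpha> \<in> Z2 L" "\<beta> \<in> Z2 L" for \<alpha> \<beta>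
    using eq_equiv_class_iff[OF r] cocycle_extension_central that cocycle_extension_equiv_iff
    by blast
  have coset_Z2: "\<beta> + \<alpha> \<in> Z2 L" if "\<alpha> \<in> Z2 L" "\<beta> \<in> B2 L" for \<alpha> \<beta>
  proof -
    have "\<beta> \<in> Z2 L" using B2_subset_Z2[OF L] that by auto
    then show ?thesis using that(1)
      by (auto simp: Z2_def bilinear_forms_def linear_maps_def algebra_simps add_eq_0_iff)
  qed
  have \<Phi>: "\<Phi> (?coset \<alpha>) = ?r `` {?E \<alpha>}" if \<alpha>: "\<alpha> \<in> Z2 L" for \<alpha>
  proof -
    have "?r `` {?E \<gamma>} = ?r `` {?E \<alpha>}" if "\<gamma> \<in> ?coset \<alpha>" for \<gamma>
      using that class_eq[OF coset_Z2[OF \<alpha>] \<alpha>] by force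
    \<comment> \<open>The union of a constant family is its common value only over a non-empty index
      set.\<close>
    moreover have "?coset \<alpha> \<noteq> {}"
      using zero_in_B2[of L] by blast
    ultimately show ?thesis
      unfolding \<Phi>_def by (intro SUP_eq_const)
  qed
  show "bij_betw \<Phi> (carrier (H2 L)) (extension_classes L :: ('e, 'v) extension set set)"
  proof (rule bij_betw_imageI)
    show "inj_on \<Phi> (carrier (H2 L))"
    proof (rule inj_onI)
      fix H K assume "H \<in> carrier (H2 L)" "K \<in> carrier (H2 L)" and eq: "\<Phi> H = \<Phi> K"
      then obtain \<alpha> \<beta> where "H = ?coset \<alpha>" "K = ?coset \<beta>" "\<alpha> \<in> Z2 L" "\<beta> \<in> Z2 L"
        by (auto simp: carrier_H2)
      then show "H = K"
        using eq class_eq coset_eqI by (simp add: \<Phi>)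
    qed
    show "\<Phi> ` carrier (H2 L) = extension_classes L"
    proof
      show "\<Phi> ` carrier (H2 L) \<subseteq> extension_classes L"
        using cocycle_extension_central
        by (auto simp: carrier_H2 \<Phi> extension_classes_def intro!: quotientI)
      show "extension_classes L \<subseteq> \<Phi> ` carrier (H2 L)"
      proof
        fix K :: "('e, 'v) extension set" assume "K \<in> extension_classes L"
        then obtain e f g where E: "(e, f, g) \<in> ?C" and K: "K = ?r `` {(e, f, g)}"
          unfolding extension_classes_def by (elim quotientE) auto
        note D = central_extensionsD[OF E]
        obtain s where s: "s \<in> linear_maps L e" "\<And>x. x \<in> carrier L \<Longrightarrow> g (s x) = x"
          using sections[OF D(1) lie_homD(1)[OF D(3)] D(6)] by blast
        obtain \<alpha> where \<alpha>: "\<alpha> \<in> Z2 L" "((e, f, g), ?E \<alpha>) \<in> ?r"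
          using extension_equiv_cocycle_extension[OF emb E s] by blast
        have "K = \<Phi> (?coset \<alpha>)"
          using equiv_class_eq[OF r \<alpha>(2)] by (simp only: K \<Phi>[OF \<alpha>(1)])
        then show "K \<in> \<Phi> ` carrier (H2 L)"
          using \<alpha>(1) by (auto simp: carrier_H2)
      qed
    qed
  qed
qed

section \<open>Plesken Lie algebras\<close>

lemma vector_space_ga_smult: "vector_space (ga_smult :: complex \<Rightarrow> ('g \<Rightarrow> complex) \<Rightarrow> _)"
  by unfold_locales (auto simp: ga_smult_def algebra_simps)

text \<open>Turns the span in the definition of \<open>plesken\<close> into \<open>ga.span\<close>
  and gives access to bases and coordinates.\<close>

interpretation ga: vector_space "ga_smult :: complex \<Rightarrow> ('g \<Rightarrow> complex) \<Rightarrow> 'g \<Rightarrow> complex"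
  by (rule vector_space_ga_smult)

lemma plesken_simps:
  "carrier (plesken G) = ga.span (plesken_gen G ` carrier G)"
  "\<zero>\<^bsub>plesken G\<^esub> = 0"
  "x \<oplus>\<^bsub>plesken G\<^esub> y = x + y"
  "c \<odot>\<^bsub>plesken G\<^esub> x = ga_smult c x"
  "bracket (plesken G) x y = ga_mult G x y - ga_mult G y x"
  by (auto simp: plesken_def group_algebra_def Let_def)

section \<open>The group algebra product and its commutator\<close>

locale finite_group = group G for G :: "('g, 'm) monoid_scheme" (structure) +
  assumes finite_carrier: "finite (carrier G)"
begin

text \<open>A factorization \<open>x = g h\<close> is determined by \<open>g\<close>, with
  \<open>h\<close> equal to the inverse of \<open>g\<close> times \<open>x\<close>. This turns the
  sum over pairs into a convolution; off the carrier there are no factorizations.\<close>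

lemma ga_mult_eq:
  "ga_mult G a b x = (if x \<in> carrier G then \<Sum>g\<in>carrier G. a g * b (inv g \<otimes> x) else 0)"
proof (cases "x \<in> carrier G")
  case True
  have "ga_mult G a b x = (\<Sum>(g, h) \<in> (\<lambda>g. (g, inv g \<otimes> x)) ` carrier G. a g * b h)"
    unfolding ga_mult_def using True
    by (intro sum.cong) (auto simp: image_iff m_assoc[symmetric])
  also have "\<dots> = (\<Sum>g\<in>carrier G. a g * b (inv g \<otimes> x))"
    by (subst sum.reindex) (auto simp: inj_on_def)
  finally show ?thesis using True by simp
next
  case False
  then have empty: "{(g, h). g \<in> carrier G \<and> h \<in> carrier G \<and> g \<otimes> h = x} = {}" by auto
  show ?thesis using False unfolding ga_mult_def empty by simp
qed

lemma ga_mult_add: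
  "ga_mult G (a + b) c = ga_mult G a c + ga_mult G b c"
  "ga_mult G a (b + c) = ga_mult G a b + ga_mult G a c"
  by (auto simp: ga_mult_eq fun_eq_iff algebra_simps sum.distrib)

lemma ga_mult_zero: "ga_mult G 0 b = 0" "ga_mult G a 0 = 0"
  by (auto simp: ga_mult_eq fun_eq_iff)

lemma ga_mult_diff:
  "ga_mult G (a - b) c = ga_mult G a c - ga_mult G b c"
  "ga_mult G a (b - c) = ga_mult G a b - ga_mult G a c"
  by (auto simp: ga_mult_eq fun_eq_iff algebra_simps sum_subtractf)

lemma ga_mult_smult:
  "ga_mult G (ga_smult k a) c = ga_smult k (ga_mult G a c)"
  "ga_mult G a (ga_smult k c) = ga_smult k (ga_mult G a c)"
  by (auto simp: ga_mult_eq fun_eq_iff ga_smult_def sum_distrib_left algebra_simps)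

lemma ga_mult_assoc: "ga_mult G (ga_mult G a b) c = ga_mult G a (ga_mult G b c)"
proof
  fix x
  show "ga_mult G (ga_mult G a b) c x = ga_mult G a (ga_mult G b c) x"
  proof (cases "x \<in> carrier G")
    case x: True
    have cancel: "g \<otimes> (inv g \<otimes> z) = z" "inv g \<otimes> (g \<otimes> z) = z"
      if "g \<in> carrier G" "z \<in> carrier G" for g z
      using that by (simp_all add: m_assoc[symmetric])
    \<comment> \<open>Substitute \<open>k = g h\<close>, for fixed \<open>g\<close>.\<close>
    have shift: "(\<Sum>k\<in>carrier G. b (inv g \<otimes> k) * c (inv k \<otimes> x))
        = (\<Sum>h\<in>carrier G. b h * c (inv h \<otimes> (inv g \<otimes> x)))" if g: "g \<in> carrier G" for g
      using g x
      by (intro sum.reindex_bij_witness[of _ "\<lambda>h. g \<otimes> h" "\<lambda>k. inv g \<otimes> k"])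
        (auto simp: m_assoc cancel inv_mult_group)
    have "ga_mult G (ga_mult G a b) c x
        = (\<Sum>k\<in>carrier G. \<Sum>g\<in>carrier G. a g * (b (inv g \<otimes> k) * c (inv k \<otimes> x)))"
      using x by (simp add: ga_mult_eq sum_distrib_right mult.assoc)
    also have "\<dots> = (\<Sum>g\<in>carrier G. a g * (\<Sum>k\<in>carrier G. b (inv g \<otimes> k) * c (inv k \<otimes> x)))"
      by (subst sum.swap) (simp add: sum_distrib_left)
    also have "\<dots> = ga_mult G a (ga_mult G b c) x"
      using x by (simp add: ga_mult_eq shift)
    finally show ?thesis .
  qed (simp add: ga_mult_eq)
qed

lemma ga_mult_basis:
  assumes "g \<in> carrier G" "h \<in> carrier G"
  shows "ga_mult G (ga_basis g) (ga_basis h) = ga_basis (g \<otimes> h)"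
proof
  fix x
  have "ga_mult G (ga_basis g) (ga_basis h) x
      = (if x \<in> carrier G then ga_basis h (inv g \<otimes> x) else 0)"
    using assms finite_carrier by (auto simp: ga_mult_eq ga_basis_def if_distrib[of "\<lambda>c. c * _"] cong: if_cong)
  then show "ga_mult G (ga_basis g) (ga_basis h) x = ga_basis (g \<otimes> h) x"
    using assms by (auto simp: ga_basis_def inv_solve_left' inv_solve_left)
qed

text \<open>Expanding the commutator gives eight group elements; they pair off into an element and
  its inverse with opposite signs, for instance \<open>g h\<close> and the inverse of
  \<open>h\<close> times the inverse of \<open>g\<close>.\<close>

lemma plesken_bracket_gen:
  assumes "g \<in> carrier G" "h \<in> carrier G"
  shows "bracket (plesken G) (plesken_gen G g) (plesken_gen G h)
    = plesken_gen G (g \<otimes> h) - plesken_gen G (g \<otimes> inv h) - plesken_gen G (inv g \<otimes> h)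
      + plesken_gen G (inv g \<otimes> inv h)"
  using assms
  by (simp add: plesken_simps plesken_gen_def ga_mult_diff ga_mult_basis inv_mult_group algebra_simps)

text \<open>Bilinearity reduces closure to brackets of generators. The span is unwound first in
  \<open>y\<close> against a fixed generator, then in \<open>x\<close>.\<close>

lemma plesken_bracket_closed:
  assumes x: "x \<in> carrier (plesken G)" and y: "y \<in> carrier (plesken G)"
  shows "bracket (plesken G) x y \<in> carrier (plesken G)"
proof -
  let ?S = "plesken_gen G ` carrier G"
  have gen: "bracket (plesken G) (plesken_gen G g) y \<in> ga.span ?S" if g: "g \<in> carrier G" for g
    using y unfolding plesken_simps(1)
  proof (induction rule: ga.span_induct_alt)
    case base
    show ?case unfolding plesken_simps ga_mult_zero by (simp only: diff_self ga.span_zero)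
  next
    case (step c b z)
    then obtain h where h: "h \<in> carrier G" "b = plesken_gen G h" by auto
    have "bracket (plesken G) (plesken_gen G g) b \<in> ga.span ?S"
      unfolding h plesken_bracket_gen[OF g h(1)]
      using g h by (intro ga.span_add ga.span_diff ga.span_base imageI) auto
    moreover have "bracket (plesken G) (plesken_gen G g) (ga_smult c b + z)
        = ga_smult c (bracket (plesken G) (plesken_gen G g) b) + bracket (plesken G) (plesken_gen G g) z"
      by (simp add: plesken_simps ga_mult_add ga_mult_smult ga.scale_right_diff_distrib)
    ultimately have "bracket (plesken G) (plesken_gen G g) (ga_smult c b + z) \<in> ga.span ?S"
      using step by (auto intro: ga.span_add ga.span_scale)
    then show ?case .
  qed
  show ?thesis
    using x unfolding plesken_simps(1)
  proof (induction rule: ga.span_induct_alt)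
    case base
    show ?case unfolding plesken_simps ga_mult_zero by (simp only: diff_self ga.span_zero)
  next
    case (step c b z)
    have "bracket (plesken G) (ga_smult c b + z) y
        = ga_smult c (bracket (plesken G) b y) + bracket (plesken G) z y"
      by (simp add: plesken_simps ga_mult_add ga_mult_smult ga.scale_right_diff_distrib)
    then have "bracket (plesken G) (ga_smult c b + z) y \<in> ga.span ?S"
      using step gen by (auto intro: ga.span_add ga.span_scale)
    then show ?case .
  qed
qed

lemma plesken_lie_algebra: "lie_algebra (plesken G)"
proof (rule lie_algebraI)
  show "abelian_group (plesken G)"
  proof (rule abelian_groupI)
    fix x assume "x \<in> carrier (plesken G)"
    then show "\<exists>y\<in>carrier (plesken G). y \<oplus>\<^bsub>plesken G\<^esub> x = \<zero>\<^bsub>plesken G\<^esub>"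
      by (intro bexI[of _ "- x"]) (auto simp: plesken_simps ga.span_neg)
  qed (auto simp: plesken_simps ga.span_add ga.span_zero add_ac)
  show "lie_algebra_axioms (plesken G)"
  proof unfold_locales
    fix x y z assume "x \<in> carrier (plesken G)" "y \<in> carrier (plesken G)" "z \<in> carrier (plesken G)"
    show "bracket (plesken G) (bracket (plesken G) x y) z
        \<oplus>\<^bsub>plesken G\<^esub> bracket (plesken G) (bracket (plesken G) y z) x
        \<oplus>\<^bsub>plesken G\<^esub> bracket (plesken G) (bracket (plesken G) z x) y = \<zero>\<^bsub>plesken G\<^esub>"
      \<comment> \<open>Jacobi for a commutator: after expansion, associativity makes all terms
        cancel.\<close>
      by (simp add: plesken_simps ga_mult_diff ga_mult_assoc)
  qed (auto simp: plesken_bracket_closed,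
      auto simp: plesken_simps ga_mult_add ga_mult_smult ga.scale_right_diff_distrib)
qed (auto simp: plesken_simps ga.span_scale ga.scale_left_distrib ga.scale_right_distrib)

text \<open>Lift the vectors of a finite basis through \<open>g\<close> and extend linearly.\<close>

lemma plesken_section:
  assumes "lie_algebra e" and g: "g \<in> linear_maps e (plesken G)" "g ` carrier e = carrier (plesken G)"
  shows "\<exists>s\<in>linear_maps (plesken G) e. \<forall>x\<in>carrier (plesken G). g (s x) = x"
proof -
  interpret e: lie_algebra e by fact
  interpret P: lie_algebra "plesken G" by (rule plesken_lie_algebra)
  note gD = linear_mapsD[OF g(1)]
  \<comment> \<open>The basis is selected among the generators, hence finite because the group
    is.\<close>
  obtain B where B: "B \<subseteq> plesken_gen G ` carrier G" "ga.independent B"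
    and span_B: "ga.span B = carrier (plesken G)"
    unfolding plesken_simps
    by (metis ga.maximal_independent_subset ga.span_eq ga.span_superset subset_trans)
  have fin: "finite B"
    using B(1) finite_carrier finite_subset by blast
  define q where "q b = (SOME v. v \<in> carrier e \<and> g v = b)" for b
  have q: "q b \<in> carrier e" "g (q b) = b" if "b \<in> B" for b
  proof -
    have "b \<in> g ` carrier e"
      using that g(2) span_B ga.span_base by blast
    then show "q b \<in> carrier e" "g (q b) = b"
      unfolding q_def using someI_ex[of "\<lambda>v. v \<in> carrier e \<and> g v = b"] by blast+
  qed
  \<comment> \<open>Summing over all of \<open>B\<close>, not only over the support of
    \<open>x\<close>, keeps the index set the same for every \<open>x\<close>, so linearity can be
    checked termwise.\<close>
  define s where "s x = (\<Oplus>\<^bsub>e\<^esub>b\<in>B. ga.representation B x b \<odot>\<^bsub>e\<^esub> q b)" for x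
  have closed: "(\<lambda>b. c b \<odot>\<^bsub>e\<^esub> q b) \<in> B \<rightarrow> carrier e" for c
    using q e.scalar_closed by auto
  have "s \<in> linear_maps (plesken G) e"
  proof (rule linear_mapsI)
    fix x assume "x \<in> carrier (plesken G)"
    show "s x \<in> carrier e"
      unfolding s_def by (rule e.M.finsum_closed[OF closed])
  next
    fix x y assume "x \<in> carrier (plesken G)" "y \<in> carrier (plesken G)"
    then have "ga.representation B (x + y) = (\<lambda>b. ga.representation B x b + ga.representation B y b)"
      using B(2) by (intro ga.representation_add) (auto simp: span_B)
    then have "s (x + y) = (\<Oplus>\<^bsub>e\<^esub>b\<in>B. ga.representation B x b \<odot>\<^bsub>e\<^esub> q b
        \<oplus>\<^bsub>e\<^esub> ga.representation B y b \<odot>\<^bsub>e\<^esub> q b)"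
      unfolding s_def using q
      by (intro e.M.finsum_cong') (auto simp: e.scalar)
    then show "s (x \<oplus>\<^bsub>plesken G\<^esub> y) = s x \<oplus>\<^bsub>e\<^esub> s y"
      unfolding s_def plesken_simps by (simp add: e.M.finsum_addf closed)
  next
    fix c x assume "x \<in> carrier (plesken G)"
    then have "ga.representation B (ga_smult c x) = (\<lambda>b. c * ga.representation B x b)"
      using B(2) by (intro ga.representation_scale) (auto simp: span_B)
    then have "s (ga_smult c x) = (\<Oplus>\<^bsub>e\<^esub>b\<in>B. c \<odot>\<^bsub>e\<^esub> (ga.representation B x b \<odot>\<^bsub>e\<^esub> q b))"
      unfolding s_def using q
      by (intro e.M.finsum_cong') (auto simp: e.scalar)
    then show "s (c \<odot>\<^bsub>plesken G\<^esub> x) = c \<odot>\<^bsub>e\<^esub> s x"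
      unfolding s_def plesken_simps using e.finsum_smult_ldistr[OF fin, of c] closed by simp
  qed
  moreover have "g (s x) = x" if x: "x \<in> carrier (plesken G)" for x
  proof -
    \<comment> \<open>Stated for subsets of \<open>B\<close> and arbitrary coefficients so that
      induction on the finite index set goes through.\<close>
    have "g (\<Oplus>\<^bsub>e\<^esub>b\<in>A. c b \<odot>\<^bsub>e\<^esub> q b) = (\<Sum>b\<in>A. ga_smult (c b) b)" if "A \<subseteq> B" for A c
      using finite_subset[OF that fin] that
    proof (induction A rule: finite_induct)
      case empty
      then show ?case
        using linear_maps_zero[OF g(1) e.lie_algebra_axioms P.lie_algebra_axioms]
        by (simp add: plesken_simps)
    next
      case (insert b A)
      have "(\<lambda>b. c b \<odot>\<^bsub>e\<^esub> q b) \<in> A \<rightarrow> carrier e" "c b \<odot>\<^bsub>e\<^esub> q b \<in> carrier e"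
        using insert closed[of c] by auto
      then show ?case
        using insert q gD by (simp add: plesken_simps)
    qed
    then have "g (s x) = (\<Sum>b\<in>B. ga_smult (ga.representation B x b) b)"
      unfolding s_def by blast
    also have "\<dots> = x"
      using B(2) x fin by (intro ga.sum_representation_eq) (auto simp: span_B)
    finally show ?thesis .
  qed
  ultimately show ?thesis by blast
qed

end

section \<open>Room for the extensions in any type containing \<open>\<complex>\<close>\<close>

lemma inj_complex_pair: "\<exists>p :: complex \<times> complex \<Rightarrow> complex. inj p"
proof -
  have "infinite (UNIV :: complex set)"
    by (rule infinite_UNIV_char_0)
  \<comment> \<open>An infinite set is equipotent with its square.\<close>
  then have "|UNIV \<times> UNIV :: (complex \<times> complex) set| \<le>o |UNIV :: complex set|"
    by (intro ordIso_imp_ordLeq card_of_Times_same_infinite)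
  then show ?thesis
    by (auto simp: card_of_ordLeq[symmetric])
qed

lemma inj_on_finite_support:
  assumes "finite S"
  shows "\<exists>k :: ('g \<Rightarrow> complex) \<Rightarrow> complex. inj_on k {a. \<forall>x. x \<notin> S \<longrightarrow> a x = 0}"
  using assms
proof (induction S)
  case empty
  \<comment> \<open>Only the zero function has empty support, so a constant map is injective
    here.\<close>
  show ?case by (rule exI[of _ "\<lambda>_. 0"]) (auto simp: inj_on_def fun_eq_iff)
next
  case (insert y S)
  then obtain k :: "('g \<Rightarrow> complex) \<Rightarrow> complex" where k: "inj_on k {a. \<forall>x. x \<notin> S \<longrightarrow> a x = 0}"
    by blast
  obtain p :: "complex \<times> complex \<Rightarrow> complex" where p: "inj p"
    using inj_complex_pair by blast
  \<comment> \<open>Split off the coordinate at \<open>y\<close>: setting it to 0 leaves a function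
    supported on \<open>S\<close>, whose code under \<open>k\<close> is packed together with
    \<open>a y\<close>.\<close>
  have "inj_on (\<lambda>a. p (a y, k (a(y := 0)))) {a. \<forall>x. x \<notin> insert y S \<longrightarrow> a x = 0}"
  proof (rule inj_onI)
    fix a b assume a: "a \<in> {a. \<forall>x. x \<notin> insert y S \<longrightarrow> a x = 0}"
      and b: "b \<in> {a. \<forall>x. x \<notin> insert y S \<longrightarrow> a x = 0}"
      and eq: "p (a y, k (a(y := 0))) = p (b y, k (b(y := 0)))"
    have "a y = b y" "k (a(y := 0)) = k (b(y := 0))"
      using injD[OF p eq] by auto
    moreover from this have "a(y := 0) = b(y := 0)"
      using a b by (intro inj_onD[OF k]) auto
    ultimately show "a = b"
      by (metis fun_upd_triv fun_upd_upd)
  qed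
  then show ?case by blast
qed

text \<open>Elements of the span are supported on the finite carrier of \<open>G\<close>, since the
  generators are. So \<open>k\<close> encodes them as complex numbers, \<open>p\<close> packs the
  code with the central coordinate, and \<open>j\<close> moves the result into
  \<open>'e\<close>.\<close>

lemma (in finite_group) plesken_embedding:
  assumes "inj (j :: complex \<Rightarrow> 'e)"
  shows "\<exists>h :: ('g \<Rightarrow> complex) \<times> complex \<Rightarrow> 'e. inj_on h (carrier (plesken G) \<times> UNIV)"
proof -
  obtain k :: "('g \<Rightarrow> complex) \<Rightarrow> complex" where k: "inj_on k (ga_carrier G)"
    using inj_on_finite_support[OF finite_carrier] by (auto simp: ga_carrier_def)
  obtain p :: "complex \<times> complex \<Rightarrow> complex" where p: "inj p"
    using inj_complex_pair by blast
  have "ga.subspace (ga_carrier G)"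
    by (auto simp: ga.subspace_def ga_carrier_def ga_smult_def)
  then have "carrier (plesken G) \<subseteq> ga_carrier G"
    unfolding plesken_simps
    by (intro ga.span_minimal) (auto simp: plesken_gen_def ga_basis_def ga_carrier_def)
  then have "inj_on (\<lambda>(x, a). j (p (k x, a))) (carrier (plesken G) \<times> UNIV)"
    using assms p by (intro inj_onI) (auto simp: inj_eq intro: inj_onD[OF k])
  then show ?thesis by blast
qed

theorem theorem2p1:
  fixes G :: "('g, 'm) monoid_scheme"
  assumes "group G" and "finite (carrier G)"
    and "\<exists>h :: complex \<Rightarrow> 'e. inj h"
  shows "\<exists>\<Phi>. bij_betw \<Phi> (carrier (H2 (plesken G)))
           (extension_classes (plesken G) :: ('e, 'g \<Rightarrow> complex) extension set set)"
proof -
  interpret finite_group G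
    using assms by (simp add: finite_group_def finite_group_axioms_def)
  obtain h :: "('g \<Rightarrow> complex) \<times> complex \<Rightarrow> 'e" where "inj_on h (carrier (plesken G) \<times> UNIV)"
    using assms(3) plesken_embedding by blast
  then show ?thesis
    using H2_classifies_central_extensions[OF plesken_lie_algebra] plesken_section by blast
qed

end
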